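(* Let $(\mathbf{W},\mathbf{w})$ be a Riesz fusion basis for $\mathcal{H}$ and $\mathbf{v}$ a family of weights. The following assertions hold: (1) If $(\mathbf{V},\mathbf{v})$ is a block-diagonal dual fusion frame of $(\mathbf{W},\mathbf{w})$, then $S_{\mathbf{W},\mathbf{w}}^{-1}W_i\subseteq V_i$ for each $i=1,\ldots,m$. (2) If $(\mathbf{V},\mathbf{v})$ is a Riesz fusion basis which is a block-diagonal dual fusion frame of $(\mathbf{W},\mathbf{w})$, then $V_i=S_{\mathbf{W},\mathbf{w}}^{-1}W_i$ for $i=1,\ldots,m$.
   Context: $\mathcal{H}$ is a finite-dimensional Hilbert space over $\mathbb{F}=\mathbb{R}$ or $\mathbb{C}$, $m\in\mathbb{N}$, and $L(\mathcal{X},\mathcal{Y})$ is the space of linear maps $\mathcal{X}\to\mathcal{Y}$. A Bessel fusion sequence $(\mathbf{W},\mathbf{w})=\{(W_i,w_i)\}_{i=1}^m$ is a family of subspaces $W_i$ of $\mathcal{H}$ with weights $w_i>0$. Put $\mathcal{W}=\bigoplus_{i=1}^m W_i=\{(f_i)_{i=1}^m: f_i\in W_i\}$ (external direct sum) with inner product $\langle (f_i),(g_i)\rangle=\sum_i\langle f_i,g_i\rangle$; similarly $\mathcal{V}=\bigoplus_{i=1}^m V_i$ for $(\mathbf{V},\mathbf{v})$. The synthesis operator is $T_{\mathbf{W},\mathbf{w}}:\mathcal{W}\to\mathcal{H}$, $T_{\mathbf{W},\mathbf{w}}(f_i)_{i}=\sum_i w_if_i$, and its adjoint is $T^*_{\mathbf{W},\mathbf{w}}f=(w_i\pi_{W_i}f)_{i}$,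 where $\pi_{W_i}$ is the orthogonal projection onto $W_i$. $(\mathbf{W},\mathbf{w})$ is a fusion frame for $\mathcal{H}$ if $\mathrm{span}\bigcup_i W_i=\mathcal{H}$; in that case $S_{\mathbf{W},\mathbf{w}}=T_{\mathbf{W},\mathbf{w}}T^*_{\mathbf{W},\mathbf{w}}$, i.e. $S_{\mathbf{W},\mathbf{w}}f=\sum_i w_i^2\pi_{W_i}f$, is the (invertible) fusion frame operator. $(\mathbf{W},\mathbf{w})$ is a Riesz fusion basis if $\mathcal{H}$ is the (internal) direct sum of the $W_i$. $M_{j,\mathbf{W}}:\mathcal{W}\to\mathcal{W}$ is the operator that keeps the $j$-th component and replaces all others by $0$; $M_{j,\mathbf{V}}$ is the analogous operator on $\mathcal{V}$. A map $Q\in L(\mathcal{W},\mathcal{V})$ is block-diagonal if $QM_{j,\mathbf{W}}\mathcal{W}\subseteq M_{j,\mathbf{V}}\mathcal{V}$ for each $j$. If $(\mathbf{W},\mathbf{w})$, $(\mathbf{V},\mathbf{v})$ are fusion frames for $\mathcal{H}$, then $(\mathbf{V},\mathbf{v})$ is a block-diagonal dual fusion frame of $(\mathbf{W},\mathbf{w})$ if there is a block-diagonal $Q\in L(\mathcal{W},\mathcal{V})$ with $T_{\mathbf{V},\mathbf{v}}QT^*_{\mathbf{W},\mathbf{w}}=I_{\mathcal{H}}$. *)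

theory Defs
  imports Complex_Main
begin

text \<open>
  The scalar field is \<open>\<real>\<close> or \<open>\<complex>\<close>. The axioms of \<open>rc_field\<close> are satisfied by both (instances
  below) and, up to isomorphism, by nothing else: by Ostrowski's theorem a field that is a real
  normed algebra with multiplicative norm is \<open>\<real>\<close> or \<open>\<complex>\<close>, and the last axiom determines the
  conjugation.
\<close>

class rc_field = real_normed_field +
  fixes conjg :: "'a \<Rightarrow> 'a"
  assumes conjg_add: "conjg (x + y) = conjg x + conjg y"
    and conjg_mult: "conjg (x * y) = conjg x * conjg y"
    and conjg_conjg: "conjg (conjg x) = x"
    and mult_conjg: "x * conjg x = (norm x)\<^sup>2 *\<^sub>R 1"

instantiation real :: rc_field
begin
definition conjg_real :: "real \<Rightarrow> real" where "conjg_real x = x"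
instance by standard (auto simp: conjg_real_def power2_eq_square)
end

instantiation complex :: rc_field
begin
definition conjg_complex :: "complex \<Rightarrow> complex" where "conjg_complex = cnj"
instance
proof
  fix x :: complex
  show "x * conjg x = (norm x)\<^sup>2 *\<^sub>R 1"
    unfolding conjg_complex_def scaleR_conv_of_real complex_norm_square by simp
qed (simp_all add: conjg_complex_def)
end

text \<open>
  The Hilbert space is the whole type \<open>'h\<close>; completeness is automatic in finite dimension.
  The inner product is linear in its first argument.
\<close>

locale fin_dim_hilbert = vector_space scale
  for scale :: "'k::rc_field \<Rightarrow> 'h::ab_group_add \<Rightarrow> 'h" (infixr \<open>*s\<close> 75) +
  fixes ip :: "'h \<Rightarrow> 'h \<Rightarrow> 'k"
  assumes ip_add_left: "ip (x + y) z = ip x z + ip y z"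
    and ip_scale_left: "ip (c *s x) y = c * ip x y"
    and ip_conjg: "ip y x = conjg (ip x y)"
    and ip_pos: "x \<noteq> 0 \<Longrightarrow> \<exists>r>0. ip x x = of_real r"
    and fin_dim: "\<exists>B. finite B \<and> span B = UNIV"
begin

definition orth_proj :: "'h set \<Rightarrow> 'h \<Rightarrow> 'h" where
  "orth_proj U x = (THE p. p \<in> U \<and> (\<forall>y\<in>U. ip (x - p) y = 0))"

definition bessel_fusion_sequence :: "nat \<Rightarrow> (nat \<Rightarrow> 'h set) \<Rightarrow> (nat \<Rightarrow> real) \<Rightarrow> bool" where
  "bessel_fusion_sequence m W w \<longleftrightarrow> (\<forall>i\<in>{1..m}. subspace (W i) \<and> w i > 0)"

text \<open>
  A tuple \<open>(f\<^sub>1, \<dots>, f\<^sub>m)\<close> is represented by the function on \<open>nat\<close> that vanishes outside \<open>{1..m}\<close>.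
\<close>

definition ext_sum :: "nat \<Rightarrow> (nat \<Rightarrow> 'h set) \<Rightarrow> (nat \<Rightarrow> 'h) set" where
  "ext_sum m W = {f. (\<forall>i\<in>{1..m}. f i \<in> W i) \<and> (\<forall>i. i \<notin> {1..m} \<longrightarrow> f i = 0)}"

definition ext_ip :: "nat \<Rightarrow> (nat \<Rightarrow> 'h) \<Rightarrow> (nat \<Rightarrow> 'h) \<Rightarrow> 'k" where
  "ext_ip m f g = (\<Sum>i=1..m. ip (f i) (g i))"

definition synthesis :: "nat \<Rightarrow> (nat \<Rightarrow> real) \<Rightarrow> (nat \<Rightarrow> 'h) \<Rightarrow> 'h" where
  "synthesis m w f = (\<Sum>i=1..m. of_real (w i) *s f i)"

text \<open>
  The adjoint of \<open>synthesis m w\<close> as a map on \<open>ext_sum m W\<close>; the explicit formula is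
  \<open>analysis_eq\<close> below.
\<close>

definition analysis :: "nat \<Rightarrow> (nat \<Rightarrow> 'h set) \<Rightarrow> (nat \<Rightarrow> real) \<Rightarrow> 'h \<Rightarrow> (nat \<Rightarrow> 'h)" where
  "analysis m W w x =
     (THE g. g \<in> ext_sum m W \<and> (\<forall>f\<in>ext_sum m W. ip (synthesis m w f) x = ext_ip m f g))"

definition fusion_frame :: "nat \<Rightarrow> (nat \<Rightarrow> 'h set) \<Rightarrow> (nat \<Rightarrow> real) \<Rightarrow> bool" where
  "fusion_frame m W w \<longleftrightarrow> bessel_fusion_sequence m W w \<and> span (\<Union>i\<in>{1..m}. W i) = UNIV"

definition frame_operator :: "nat \<Rightarrow> (nat \<Rightarrow> 'h set) \<Rightarrow> (nat \<Rightarrow> real) \<Rightarrow> 'h \<Rightarrow> 'h" where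
  "frame_operator m W w x = synthesis m w (analysis m W w x)"

definition riesz_fusion_basis :: "nat \<Rightarrow> (nat \<Rightarrow> 'h set) \<Rightarrow> (nat \<Rightarrow> real) \<Rightarrow> bool" where
  "riesz_fusion_basis m W w \<longleftrightarrow> bessel_fusion_sequence m W w \<and>
     (\<forall>x. \<exists>!f. f \<in> ext_sum m W \<and> x = (\<Sum>i=1..m. f i))"

definition keep_component :: "nat \<Rightarrow> (nat \<Rightarrow> 'h) \<Rightarrow> (nat \<Rightarrow> 'h)" where
  "keep_component j f = (\<lambda>i. if i = j then f i else 0)"

text \<open>
  Linear maps between subspaces \<open>X\<close>, \<open>Y\<close> of \<open>nat \<Rightarrow> 'h\<close>; values outside \<open>X\<close> are irrelevant.
\<close>

definition linear_maps ::
    "(nat \<Rightarrow> 'h) set \<Rightarrow> (nat \<Rightarrow> 'h) set \<Rightarrow> ((nat \<Rightarrow> 'h) \<Rightarrow> (nat \<Rightarrow> 'h)) set" where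
  "linear_maps X Y = {Q. Q ` X \<subseteq> Y \<and>
     (\<forall>f\<in>X. \<forall>g\<in>X. Q (\<lambda>i. f i + g i) = (\<lambda>i. Q f i + Q g i)) \<and>
     (\<forall>c. \<forall>f\<in>X. Q (\<lambda>i. c *s f i) = (\<lambda>i. c *s Q f i))}"

definition block_diagonal ::
    "nat \<Rightarrow> (nat \<Rightarrow> 'h set) \<Rightarrow> (nat \<Rightarrow> 'h set) \<Rightarrow> ((nat \<Rightarrow> 'h) \<Rightarrow> (nat \<Rightarrow> 'h)) \<Rightarrow> bool" where
  "block_diagonal m W V Q \<longleftrightarrow>
     (\<forall>j\<in>{1..m}. Q ` keep_component j ` ext_sum m W \<subseteq> keep_component j ` ext_sum m V)"

text \<open>\<open>(V, v)\<close> is a block-diagonal dual fusion frame of \<open>(W, w)\<close>.\<close>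

definition block_diagonal_dual ::
    "nat \<Rightarrow> (nat \<Rightarrow> 'h set) \<Rightarrow> (nat \<Rightarrow> real) \<Rightarrow> (nat \<Rightarrow> 'h set) \<Rightarrow> (nat \<Rightarrow> real) \<Rightarrow> bool" where
  "block_diagonal_dual m W w V v \<longleftrightarrow> fusion_frame m W w \<and> fusion_frame m V v \<and>
     (\<exists>Q\<in>linear_maps (ext_sum m W) (ext_sum m V). block_diagonal m W V Q \<and>
        (\<forall>x. synthesis m v (Q (analysis m W w x)) = x))"

lemma ip_zero_left [simp]: "ip 0 y = 0"
  using ip_scale_left[of 0 0 y] by simp

lemma conjg_zero [simp]: "conjg (0::'k) = 0"
  using conjg_add[of "0::'k" 0] by simp

lemma ip_zero_right [simp]: "ip x 0 = 0"
  by (metis ip_conjg ip_zero_left conjg_zero)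

lemma ip_eq_0_sym: "ip x y = 0 \<Longrightarrow> ip y x = 0"
  by (metis ip_conjg conjg_zero)

lemma ip_add_right: "ip x (y + z) = ip x y + ip x z"
  by (metis ip_conjg ip_add_left conjg_add)

lemma ip_scale_right: "ip x (c *s y) = conjg c * ip x y"
  by (metis ip_conjg ip_scale_left conjg_mult)

lemma ip_diff_left: "ip (x - y) z = ip x z - ip y z"
  using ip_add_left[of "x - y" y z] by simp

lemma ip_diff_right: "ip x (y - z) = ip x y - ip x z"
  using ip_add_right[of x "y - z" z] by simp

lemma ip_self_eq_0 [simp]: "ip x x = 0 \<longleftrightarrow> x = 0"
  using ip_pos[of x] by (cases "x = 0") auto

lemma conjg_of_real [simp]: "conjg (of_real r :: 'k) = of_real r"
proof (cases "r = 0")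
  case False
  have "of_real r * conjg (of_real r :: 'k) = of_real r * of_real r"
    by (simp add: mult_conjg power2_eq_square scaleR_conv_of_real)
  then show ?thesis using False by simp
qed simp

lemma finite_spanning_subspace:
  assumes "subspace U" shows "\<exists>B. finite B \<and> span B = U"
proof -
  obtain C where C: "finite C" "span C = UNIV" using fin_dim by blast
  obtain B where B: "B \<subseteq> U" "independent B" "U \<subseteq> span B"
    using maximal_independent_subset[of U] by blast
  have "finite B" using independent_span_bound[OF C(1) B(2)] C(2) by auto
  then show ?thesis using B assms span_minimal by blast
qed

lemma orth_decomposition:
  assumes "finite B" shows "\<exists>p\<in>span B. \<forall>y\<in>span B. ip (x - p) y = 0"
  using assms
proof (induction B arbitrary: x)
  case empty
  then show ?case by simp
next
  case (insert a B)
  obtain q where q: "q \<in> span B" "\<forall>y\<in>span B. ip (x - q) y = 0" using insert.IH[of x] by blast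
  obtain r where r: "r \<in> span B" "\<forall>y\<in>span B. ip (a - r) y = 0" using insert.IH[of a] by blast
  define b where "b = a - r"
  define c where "c = (if b = 0 then 0 else ip (x - q) b / ip b b)"
  define p where "p = q + c *s b"
  have sub: "span B \<subseteq> span (insert a B)" by (rule span_mono) auto
  have b: "b \<in> span (insert a B)" unfolding b_def 
    by (rule span_diff) (use r sub in \<open>auto intro: span_base\<close>)
  have p: "p \<in> span (insert a B)" unfolding p_def by (rule span_add, use q sub in blast, rule span_scale[OF b])
  have orthB: "ip (x - p) y = 0" if "y \<in> span B" for y
    using q(2) r(2) that
    by (simp add: p_def b_def ip_diff_left ip_add_left ip_scale_left)
  have orthb: "ip (x - p) b = 0"
    by (simp add: p_def c_def ip_diff_left ip_add_left ip_scale_left)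
  have "ip (x - p) y = 0" if y: "y \<in> span (insert a B)" for y
  proof -
    obtain k where k: "y - k *s a \<in> span B" using y span_breakdown_eq by blast
    have "y = (y - k *s a + k *s r) + k *s b" by (simp add: b_def scale_right_diff_distrib)
    moreover have z: "y - k *s a + k *s r \<in> span B" by (rule span_add[OF k span_scale[OF r(1)]])
    ultimately have "ip (x - p) y = ip (x - p) (y - k *s a + k *s r) + ip (x - p) (k *s b)"
      by (metis ip_add_right)
    then show ?thesis
      using orthB[OF z] orthb by (simp add: ip_scale_right)
  qed
  with p show ?case by blast
qed

lemma orth_proj_unique:
  assumes "subspace U" "p \<in> U" "\<forall>y\<in>U. ip (x - p) y = 0" "q \<in> U" "\<forall>y\<in>U. ip (x - q) y = 0"
  shows "p = q"
proof -
  have "p - q \<in> U" using assms subspace_diff by blast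
  then have "ip (x - q) (p - q) - ip (x - p) (p - q) = 0" using assms by simp
  then have "ip (p - q) (p - q) = 0" by (simp add: ip_diff_left)
  then show ?thesis by simp
qed

lemma orth_proj:
  assumes "subspace U"
  shows "orth_proj U x \<in> U" "\<And>y. y \<in> U \<Longrightarrow> ip (x - orth_proj U x) y = 0"
proof -
  have "\<exists>!p. p \<in> U \<and> (\<forall>y\<in>U. ip (x - p) y = 0)"
    using finite_spanning_subspace[OF assms] orth_decomposition orth_proj_unique[OF assms] by blast
  from theI'[OF this]
  show "orth_proj U x \<in> U" "\<And>y. y \<in> U \<Longrightarrow> ip (x - orth_proj U x) y = 0"
    by (auto simp: orth_proj_def)
qed

lemma ip_sum_left: "ip (\<Sum>i\<in>A. f i) y = (\<Sum>i\<in>A. ip (f i) y)"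
  by (induction A rule: infinite_finite_induct) (auto simp: ip_add_left)

lemma analysis_eq:
  assumes "bessel_fusion_sequence m W w"
  shows "analysis m W w x = (\<lambda>i. if i \<in> {1..m} then of_real (w i) *s orth_proj (W i) x else 0)"
    (is "_ = ?g")
proof -
  have sub: "subspace (W i)" if "i \<in> {1..m}" for i
    using assms that by (auto simp: bessel_fusion_sequence_def)
  have g: "?g \<in> ext_sum m W"
    by (simp add: ext_sum_def subspace_scale sub orth_proj(1))
  have adj: "ip (synthesis m w f) x = ext_ip m f ?g" if f: "f \<in> ext_sum m W" for f
  proof -
    have "ip (f i) x = ip (f i) (orth_proj (W i) x)" if i: "i \<in> {1..m}" for i
    proof -
      have "ip (f i) (x - orth_proj (W i) x) = 0"
        by (rule ip_eq_0_sym, rule orth_proj(2)[OF sub[OF i]]) (use f i in \<open>simp add: ext_sum_def\<close>)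
      then show ?thesis by (simp add: ip_diff_right)
    qed
    then show ?thesis
      by (auto simp: synthesis_def ext_ip_def ip_sum_left ip_scale_left ip_scale_right
          intro!: sum.cong)
  qed
  have uniq: "h = ?g"
    if h: "h \<in> ext_sum m W" "\<forall>f\<in>ext_sum m W. ip (synthesis m w f) x = ext_ip m f h" for h
  proof
    fix j
    show "h j = ?g j"
    proof (cases "j \<in> {1..m}")
      case True
      define d where "d = h j - ?g j"
      define f where "f = (\<lambda>i. if i = j then d else 0)"
      have "d \<in> W j"
        using h(1) g True sub[OF True] unfolding d_def ext_sum_def by (simp add: subspace_diff)
      then have f: "f \<in> ext_sum m W"
        using True by (simp add: f_def ext_sum_def subspace_0 sub)
      have ev: "ext_ip m f k = ip d (k j)" for k
      proof -
        have "ext_ip m f k = (\<Sum>i=1..m. if i = j then ip d (k i) else 0)"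
          unfolding ext_ip_def f_def by (intro sum.cong) auto
        then show ?thesis using True by (simp add: sum.delta)
      qed
      have "ip d (h j) = ip d (?g j)" using adj[OF f] h(2) f ev by metis
      then have "ip d d = 0" unfolding d_def by (metis ip_diff_right diff_self)
      then show ?thesis by (simp add: d_def)
    qed (use h in \<open>auto simp: ext_sum_def\<close>)
  qed
  show ?thesis unfolding analysis_def using g adj uniq by (intro the_equality) blast+
qed

lemma frame_operator_eq:
  assumes "bessel_fusion_sequence m W w"
  shows "frame_operator m W w x = (\<Sum>i=1..m. of_real ((w i)\<^sup>2) *s orth_proj (W i) x)"
  unfolding frame_operator_def analysis_eq[OF assms] synthesis_def
  by (rule sum.cong) (simp_all add: power2_eq_square)

end

end

theory Submission
  imports Defs
begin

text \<open>
  If \<open>S y \<in> W\<^sub>i\<close>, then uniqueness of the decomposition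
  \<open>S y = \<Sum>\<^sub>j w\<^sub>j\<^sup>2 \<pi>\<^sub>W\<^sub>j y\<close> along the Riesz fusion basis forces the analysis coefficients of \<open>y\<close> to be
  concentrated in component \<open>i\<close>. A block-diagonal \<open>Q\<close> preserves this, so
  \<open>y = T\<^sub>V Q T\<^sub>W\<^sup>* y\<close> lies in \<open>V\<^sub>i\<close>. If the \<open>V\<^sub>i\<close> are a direct sum too, decompose
  \<open>S y = \<Sum>\<^sub>j x\<^sub>j\<close> for \<open>y \<in> V\<^sub>i\<close>; then \<open>y = \<Sum>\<^sub>j S\<^sup>-\<^sup>1 x\<^sub>j\<close> with \<open>S\<^sup>-\<^sup>1 x\<^sub>j \<in> V\<^sub>j\<close>, so \<open>y = S\<^sup>-\<^sup>1 x\<^sub>i\<close>.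
\<close>

context fin_dim_hilbert
begin

lemma orth_proj_eqI:
  assumes "subspace U" "p \<in> U" "\<And>y. y \<in> U \<Longrightarrow> ip (x - p) y = 0"
  shows "orth_proj U x = p"
  using orth_proj_unique[OF assms(1)] orth_proj[OF assms(1)] assms(2,3) by blast

lemma orth_proj_add:
  assumes "subspace U"
  shows "orth_proj U (x + y) = orth_proj U x + orth_proj U y"
proof (rule orth_proj_eqI[OF assms])
  fix z assume "z \<in> U"
  then have "ip (x - orth_proj U x) z + ip (y - orth_proj U y) z = 0"
    using orth_proj(2)[OF assms] by simp
  then show "ip (x + y - (orth_proj U x + orth_proj U y)) z = 0"
    by (simp add: ip_diff_left ip_add_left algebra_simps)
qed (simp add: assms orth_proj(1) subspace_add)

lemma orth_proj_scale:
  assumes "subspace U"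
  shows "orth_proj U (c *s x) = c *s orth_proj U x"
proof (rule orth_proj_eqI[OF assms])
  fix z assume "z \<in> U"
  then have "c * ip (x - orth_proj U x) z = 0"
    using orth_proj(2)[OF assms] by simp
  then show "ip (c *s x - c *s orth_proj U x) z = 0"
    by (simp add: ip_diff_left ip_scale_left algebra_simps)
qed (simp add: assms orth_proj(1) subspace_scale)

lemma linear_frame_operator:
  assumes "bessel_fusion_sequence m W w"
  shows "Vector_Spaces.linear scale scale (frame_operator m W w)"
proof -
  have "subspace (W i)" if "i \<in> {1..m}" for i
    using assms that by (simp add: bessel_fusion_sequence_def)
  then show ?thesis
    unfolding Vector_Spaces.linear_iff frame_operator_eq[OF assms]
    by (auto simp: vector_space_axioms orth_proj_add orth_proj_scale scale_right_distrib
        scale_left_commute scale_sum_right sum.distrib mult.commute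
        intro!: sum.cong)
qed

text \<open>Finite dimension is given only by a finite spanning set. A maximal independent set has
  at most as many elements, so it is a finite basis, and over it injectivity of an endomorphism
  forces surjectivity.\<close>

lemma linear_inj_imp_bij:
  assumes "Vector_Spaces.linear scale scale f" "inj f"
  shows "bij f"
proof -
  obtain C where C: "finite C" "span C = UNIV" using fin_dim by blast
  obtain B where B: "independent B" "UNIV \<subseteq> span B"
    by (rule maximal_independent_subset[of UNIV])
  have "finite B" using independent_span_bound[OF C(1) B(1)] C(2) by auto
  then interpret finite_dimensional_vector_space scale B
    using B by unfold_locales auto
  show ?thesis
    using linear_inj_imp_surj[OF assms] assms(2) by (simp add: bij_def)
qed

text \<open>The scaled analysis coefficients are the vectors
  \<open>w\<^sub>i\<^sup>2 \<pi>\<^sub>W\<^sub>i x\<close>. They form a decomposition of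
  \<open>S x\<close> along the \<open>W i\<close>, to which uniqueness for a Riesz fusion basis can
  be applied.\<close>

lemma frame_operator_summands:
  assumes "bessel_fusion_sequence m W w"
  shows "(\<lambda>i. of_real (w i) *s analysis m W w x i) \<in> ext_sum m W"
    and "frame_operator m W w x = (\<Sum>i=1..m. of_real (w i) *s analysis m W w x i)"
  using assms
  by (auto simp: ext_sum_def analysis_eq[OF assms] bessel_fusion_sequence_def orth_proj(1)
      subspace_scale frame_operator_def synthesis_def)

lemma analysis_in_ext_sum:
  assumes "bessel_fusion_sequence m W w"
  shows "analysis m W w x \<in> ext_sum m W"
  using assms
  by (auto simp: ext_sum_def analysis_eq[OF assms] bessel_fusion_sequence_def orth_proj(1)
      subspace_scale)

lemma riesz_fusion_basis_unique:
  assumes "riesz_fusion_basis m W w" "f \<in> ext_sum m W" "g \<in> ext_sum m W"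
    and "(\<Sum>i=1..m. f i) = (\<Sum>i=1..m. g i)"
  shows "f = g"
proof -
  have "\<exists>!h. h \<in> ext_sum m W \<and> (\<Sum>i=1..m. f i) = (\<Sum>i=1..m. h i)"
    using assms(1) unfolding riesz_fusion_basis_def by blast
  then show ?thesis using assms(2-4) by (blast intro: ex1E)
qed

lemma single_in_ext_sum:
  assumes "bessel_fusion_sequence m W w" "i \<in> {1..m}" "x \<in> W i"
  shows "(\<lambda>j. if j = i then x else 0) \<in> ext_sum m W"
  using assms by (auto simp: ext_sum_def bessel_fusion_sequence_def subspace_0)

lemma analysis_concentrated:
  assumes W: "riesz_fusion_basis m W w" and i: "i \<in> {1..m}"
    and mem: "frame_operator m W w y \<in> W i"
  shows "keep_component i (analysis m W w y) = analysis m W w y"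
proof -
  have b: "bessel_fusion_sequence m W w" using W by (simp add: riesz_fusion_basis_def)
  let ?h = "\<lambda>j. if j = i then frame_operator m W w y else 0"
  \<comment> \<open>Both tuples decompose \<open>S y\<close>; \<open>?h\<close> puts all of it in
    slot \<open>i\<close>, which is allowed because \<open>S y\<close> lies in
    \<open>W i\<close>.\<close>
  have "(\<lambda>j. of_real (w j) *s analysis m W w y j) = ?h"
  proof (rule riesz_fusion_basis_unique[OF W frame_operator_summands(1)[OF b]])
    show "?h \<in> ext_sum m W" by (rule single_in_ext_sum[OF b i mem])
    show "(\<Sum>j=1..m. of_real (w j) *s analysis m W w y j) = (\<Sum>j=1..m. ?h j)"
      using i by (simp add: frame_operator_summands(2)[OF b])
  qed
  then have eq: "of_real (w j) *s analysis m W w y j = 0" if "j \<noteq> i" for j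
    using that by meson
  have "analysis m W w y j = 0" if "j \<noteq> i" for j
  \<comment> \<open>Positivity of \<open>w j\<close>, needed to cancel it, is known only on
    \<open>{1..m}\<close>; elsewhere the analysis tuple is zero by convention.\<close>
  proof (cases "j \<in> {1..m}")
    case True
    then have "w j > 0" using b by (simp add: bessel_fusion_sequence_def)
    then show ?thesis using eq[OF that] by simp
  next
    case False
    then show ?thesis by (simp only: analysis_eq[OF b] if_False)
  qed
  then show ?thesis by (auto simp: keep_component_def)
qed

text \<open>The condition on \<open>y\<close> is put through \<open>S y\<close>; it turns into a
  statement about the inverse once \<open>S\<close> is known to be bijective.\<close>

lemma block_diagonal_dual_mem:
  assumes W: "riesz_fusion_basis m W w" and dual: "block_diagonal_dual m W w V v"
    and i: "i \<in> {1..m}" and mem: "frame_operator m W w y \<in> W i"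
  shows "y \<in> V i"
proof -
  have b: "bessel_fusion_sequence m W w" using W by (simp add: riesz_fusion_basis_def)
  obtain Q where Q: "block_diagonal m W V Q" "synthesis m v (Q (analysis m W w y)) = y"
    using dual by (auto simp: block_diagonal_dual_def)
  have V: "subspace (V i)"
    using dual i
    by (auto simp: block_diagonal_dual_def fusion_frame_def bessel_fusion_sequence_def)
  have "Q (keep_component i (analysis m W w y)) \<in> keep_component i ` ext_sum m V"
    using Q(1) i analysis_in_ext_sum[OF b] unfolding block_diagonal_def by blast
  then obtain g where g: "g \<in> ext_sum m V" "Q (analysis m W w y) = keep_component i g"
    using analysis_concentrated[OF W i mem] by auto
  have "synthesis m v (keep_component i g) = (\<Sum>j=1..m. if j = i then of_real (v i) *s g i else 0)"
    unfolding synthesis_def keep_component_def by (intro sum.cong) auto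
  then have "y = of_real (v i) *s g i"
    using i Q(2) unfolding g(2) by (simp only: sum.delta finite_atLeastAtMost if_True)
  then show ?thesis
    using g(1) i V by (simp add: ext_sum_def subspace_scale)
qed

text \<open>Makes \<open>inv\<close> a genuine inverse. If \<open>S x = S y\<close>, uniqueness of
  decompositions gives equal projections onto every \<open>W i\<close>, so \<open>x - y\<close> is
  orthogonal to every \<open>W i\<close>.\<close>

lemma bij_frame_operator:
  assumes W: "riesz_fusion_basis m W w"
  shows "bij (frame_operator m W w)"
proof (rule linear_inj_imp_bij)
  have b: "bessel_fusion_sequence m W w" using W by (simp add: riesz_fusion_basis_def)
  show "Vector_Spaces.linear scale scale (frame_operator m W w)"
    by (rule linear_frame_operator[OF b])
  show "inj (frame_operator m W w)"
  proof (rule injI)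
    fix x y assume "frame_operator m W w x = frame_operator m W w y"
    then have "(\<lambda>i. of_real (w i) *s analysis m W w x i)
        = (\<lambda>i. of_real (w i) *s analysis m W w y i)"
      using frame_operator_summands[OF b] by (intro riesz_fusion_basis_unique[OF W]) simp_all
    then have eq: "of_real (w i) *s analysis m W w x i = of_real (w i) *s analysis m W w y i" for i
      by meson
    have proj: "orth_proj (W i) x = orth_proj (W i) y" if i: "i \<in> {1..m}" for i
    proof -
      have "w i > 0" using b i by (simp add: bessel_fusion_sequence_def)
      then show ?thesis using eq[of i] i by (simp add: analysis_eq[OF b])
    qed
    \<comment> \<open>Decomposing \<open>x - y\<close> itself along the \<open>W i\<close> shows
      that it is orthogonal to itself, hence zero.\<close>
    obtain f where f: "f \<in> ext_sum m W" "x - y = (\<Sum>i=1..m. f i)"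
      using W unfolding riesz_fusion_basis_def by metis
    have "ip (f i) (x - y) = 0" if i: "i \<in> {1..m}" for i
    proof -
      have sub: "subspace (W i)" and fi: "f i \<in> W i"
        using b f(1) i by (auto simp: bessel_fusion_sequence_def ext_sum_def)
      have "ip (x - orth_proj (W i) x) (f i) - ip (y - orth_proj (W i) y) (f i) = 0"
        using orth_proj(2)[OF sub fi] by simp
      then have "ip (x - y) (f i) = 0" by (simp add: proj[OF i] ip_diff_left)
      then show ?thesis by (rule ip_eq_0_sym)
    qed
    then have "ip (\<Sum>i=1..m. f i) (x - y) = 0" by (simp add: ip_sum_left)
    then have "x - y = 0" using f(2) by (metis ip_self_eq_0)
    then show "x = y" by simp
  qed
qed

lemma inv_frame_operator_image_subset:
  assumes W: "riesz_fusion_basis m W w" and dual: "block_diagonal_dual m W w V v"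
    and i: "i \<in> {1..m}"
  shows "inv (frame_operator m W w) ` W i \<subseteq> V i"
proof -
  have "surj (frame_operator m W w)"
    using bij_frame_operator[OF W] by (rule bij_is_surj)
  then show ?thesis
    using block_diagonal_dual_mem[OF W dual i] by (auto simp: surj_f_inv_f)
qed

lemma inv_frame_operator_image_eq:
  assumes W: "riesz_fusion_basis m W w" and V: "riesz_fusion_basis m V v"
    and dual: "block_diagonal_dual m W w V v" and i: "i \<in> {1..m}"
  shows "V i = inv (frame_operator m W w) ` W i"
proof
  show "inv (frame_operator m W w) ` W i \<subseteq> V i"
    by (rule inv_frame_operator_image_subset[OF W dual i])
  show "V i \<subseteq> inv (frame_operator m W w) ` W i"
  proof
    fix y assume y: "y \<in> V i"
    let ?S = "frame_operator m W w"
    have bW: "bessel_fusion_sequence m W w" and bV: "bessel_fusion_sequence m V v"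
      using W V by (simp_all add: riesz_fusion_basis_def)
    interpret S: Vector_Spaces.linear scale scale ?S
      by (rule linear_frame_operator[OF bW])
    have bij: "bij ?S" by (rule bij_frame_operator[OF W])
    obtain x where x: "x \<in> ext_sum m W" "?S y = (\<Sum>j=1..m. x j)"
      using W unfolding riesz_fusion_basis_def by metis
    \<comment> \<open>Two candidate decompositions of \<open>y\<close> along the \<open>V j\<close>.
      The zero default is required for membership in \<open>ext_sum m V\<close>.\<close>
    let ?f = "\<lambda>j. if j \<in> {1..m} then inv ?S (x j) else 0"
    let ?g = "\<lambda>j. if j = i then y else 0"
    have "inv ?S (x j) \<in> V j" if j: "j \<in> {1..m}" for j
    proof -
      have "x j \<in> W j" using x(1) j by (simp add: ext_sum_def)
      then show ?thesis using inv_frame_operator_image_subset[OF W dual j] by blast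
    qed
    then have "?f \<in> ext_sum m V" by (simp add: ext_sum_def)
    moreover have "?g \<in> ext_sum m V" by (rule single_in_ext_sum[OF bV i y])
    moreover have "(\<Sum>j=1..m. ?f j) = (\<Sum>j=1..m. ?g j)"
    \<comment> \<open>As \<open>S\<close> is injective, it suffices to compare images: linearity
      moves \<open>S\<close> inside the sum, where it cancels the inverse and leaves the
      decomposition of \<open>S y\<close>.\<close>
    proof (rule injD[OF bij_is_inj[OF bij]])
      have "?S (\<Sum>j=1..m. ?f j) = (\<Sum>j=1..m. x j)"
        unfolding S.sum by (intro sum.cong) (auto simp: surj_f_inv_f[OF bij_is_surj[OF bij]])
      also have "\<dots> = ?S (\<Sum>j=1..m. ?g j)"
        using x(2) i by (simp add:)
      finally show "?S (\<Sum>j=1..m. ?f j) = ?S (\<Sum>j=1..m. ?g j)" .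
    qed
    ultimately have "?f = ?g"
      by (rule riesz_fusion_basis_unique[OF V])
    from fun_cong[OF this, of i] have "y = inv ?S (x i)" using i by simp
    then show "y \<in> inv ?S ` W i" using x(1) i by (auto simp: ext_sum_def)
  qed
qed

end

theorem proposition3p7:
  fixes scale :: "'k::rc_field \<Rightarrow> 'h::ab_group_add \<Rightarrow> 'h"
    and ip :: "'h \<Rightarrow> 'h \<Rightarrow> 'k"
    and m :: nat
    and W :: "nat \<Rightarrow> 'h set"
    and w v :: "nat \<Rightarrow> real"
  assumes "fin_dim_hilbert scale ip"
    and "fin_dim_hilbert.riesz_fusion_basis scale m W w"
    and "\<forall>i\<in>{1..m}. v i > 0"
  shows
    "(\<forall>V. fin_dim_hilbert.block_diagonal_dual scale ip m W w V v \<longrightarrow>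
        (\<forall>i\<in>{1..m}. inv (fin_dim_hilbert.frame_operator scale ip m W w) ` W i \<subseteq> V i)) \<and>
     (\<forall>V. fin_dim_hilbert.riesz_fusion_basis scale m V v \<and>
          fin_dim_hilbert.block_diagonal_dual scale ip m W w V v \<longrightarrow>
        (\<forall>i\<in>{1..m}. V i = inv (fin_dim_hilbert.frame_operator scale ip m W w) ` W i))"
proof -
  interpret fin_dim_hilbert scale ip by (rule assms(1))
  show ?thesis
    using inv_frame_operator_image_subset[OF assms(2)] inv_frame_operator_image_eq[OF assms(2)]
    by blast
qed

end
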